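(* The following equalities hold: $$\theta_1(B_1)=1,\quad\theta_2(B_2)=\frac53,\quad\theta_3(B_3)=2,\quad\theta_4(B_4)=\frac{11}{5}.$$ Moreover, for $1\le n\le4$ the equality $\|P\|_{B_n}=\theta_n(B_n)$, where $P:C(B_n)\to\Pi_1(\mathbb{R}^n)$ is an interpolation projector with nodes in $B_n$, holds only for projectors corresponding to regular simplices inscribed into $B_n$.
   Context: $B_n=\{x\in\mathbb{R}^n:\|x\|\le1\}$ is the Euclidean unit ball. $C(B_n)$ is the space of continuous functions $f:B_n\to\mathbb{R}$ with norm $\|f\|_{C(B_n)}=\max_{x\in B_n}|f(x)|$. $\Pi_1(\mathbb{R}^n)$ is the set of real polynomials in $n$ variables of degree at most $1$. For a nondegenerate $n$-dimensional simplex $S$ with vertices $x^{(1)},\dots,x^{(n+1)}\in B_n$, the interpolation projector $P:C(B_n)\to\Pi_1(\mathbb{R}^n)$ corresponding to $S$ (with nodes $x^{(j)}$) is determined by $Pf(x^{(j)})=f(x^{(j)})$ for $1\le j\le n+1$. $\|P\|_{B_n}$ is the norm of $P$ as an operator from $C(B_n)$ to $C(B_n)$ (with $Pf$ restricted to $B_n$). $\theta_n(B_n)$ is the minimal value of $\|P\|_{B_n}$ over all interpolation projectors $P$ corresponding to nondegenerate simplices with vertices in $B_n$. A simplex is inscribed into $B_n$ if all its vertices lie on the sphere $\|x\|=1$; it is regular if all its edges have equal length. *)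

theory Defs
  imports "HOL-Analysis.Analysis"
begin

abbreviation unit_cball :: "(real ^ 'n) set" where
  "unit_cball \<equiv> cball 0 1"

text \<open>
  Elements of \<open>C(B\<^sub>n)\<close> are represented by total functions that are continuous on the ball; only
  their values on the ball matter. For such functions the supremum below is a maximum.
\<close>

definition cont_ball :: "(real ^ 'n \<Rightarrow> real) set" where
  "cont_ball = {f. continuous_on unit_cball f}"

definition max_norm :: "(real ^ 'n \<Rightarrow> real) \<Rightarrow> real" where
  "max_norm f = (SUP x\<in>unit_cball. \<bar>f x\<bar>)"

definition linear_polys :: "(real ^ 'n \<Rightarrow> real) set" where
  "linear_polys = {p. \<exists>a c. p = (\<lambda>x. a \<bullet> x + c)}"

definition op_norm :: "((real ^ 'n \<Rightarrow> real) \<Rightarrow> (real ^ 'n \<Rightarrow> real)) \<Rightarrow> real" where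
  "op_norm P = (SUP f\<in>{f \<in> cont_ball. max_norm f \<le> 1}. max_norm (P f))"

definition vertices :: "(real ^ 'n) set \<Rightarrow> (real ^ 'n) set" where
  "vertices S = {v. v extreme_point_of S}"

definition simplex_with_nodes_in_ball :: "(real ^ 'n) set \<Rightarrow> bool" where
  "simplex_with_nodes_in_ball S \<longleftrightarrow> int CARD('n) simplex S \<and> vertices S \<subseteq> unit_cball"

definition inscribed :: "(real ^ 'n) set \<Rightarrow> bool" where
  "inscribed S \<longleftrightarrow> vertices S \<subseteq> sphere 0 1"

text \<open>The edges of a simplex are exactly the segments joining two distinct vertices.\<close>

definition regular_simplex :: "(real ^ 'n) set \<Rightarrow> bool" where
  "regular_simplex S \<longleftrightarrow> int CARD('n) simplex S \<and>
     (\<exists>l. \<forall>v\<in>vertices S. \<forall>w\<in>vertices S. v \<noteq> w \<longrightarrow> dist v w = l)"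

text \<open>
  The conditions determine \<open>P\<close> on \<^term>\<open>cont_ball\<close>; its values elsewhere are irrelevant to
  \<^term>\<open>op_norm P\<close>.
\<close>

definition interpolation_projector ::
    "(real ^ 'n) set \<Rightarrow> ((real ^ 'n \<Rightarrow> real) \<Rightarrow> (real ^ 'n \<Rightarrow> real)) \<Rightarrow> bool" where
  "interpolation_projector S P \<longleftrightarrow>
     (\<forall>f\<in>cont_ball. P f \<in> linear_polys \<and> (\<forall>v\<in>vertices S. P f v = f v))"

text \<open>
  The minimal projector norm, written as an infimum; that the infimum is attained has to be
  asserted separately.
\<close>

definition theta :: "'n::finite itself \<Rightarrow> real" where
  "theta _ = Inf {op_norm P | (P :: (real ^ 'n \<Rightarrow> real) \<Rightarrow> (real ^ 'n \<Rightarrow> real)) S.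
                    simplex_with_nodes_in_ball S \<and> interpolation_projector S P}"

end

theory Submission
  imports Defs
begin

text \<open>
  Let \<open>\<lambda>\<^sub>v\<close>, for \<open>v\<close> a vertex, be the barycentric coordinates of a simplex: the affine functions with
  \<open>\<lambda>\<^sub>v(w) = \<delta>\<^sub>v\<^sub>w\<close>. The projector is \<open>P f = \<Sum>\<^sub>v f(v) \<lambda>\<^sub>v\<close>, so every linear combination of the
  \<open>\<lambda>\<^sub>v(x)\<close> with coefficients \<open>\<plusminus>1\<close> and \<open>x\<close> in the ball bounds its norm from below, and the maximum
  of \<open>\<Sum>\<^sub>v \<bar>\<lambda>\<^sub>v(x)\<bar>\<close> bounds it from above.

  The lower bound \<open>\<parallel>P\<parallel> \<ge> (3n - 1)/(n + 1)\<close> holds in every dimension. Since \<open>\<Sum>\<^sub>v \<lambda>\<^sub>v = 1\<close>, giving the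
  coefficient \<open>-1\<close> to a single vertex \<open>v\<close> yields \<open>\<parallel>P\<parallel> \<ge> 1 - 2 \<lambda>\<^sub>v(x)\<close>. Take \<open>x = -v\<close>, which lies in
  the ball together with \<open>v\<close>: as \<open>\<lambda>\<^sub>v\<close> is affine, \<open>\<lambda>\<^sub>v(-v) = 2 \<lambda>\<^sub>v(0) - 1\<close>, and these numbers add up
  to \<open>2 - (n + 1)\<close>. So some \<open>\<lambda>\<^sub>v(-v)\<close> is at most \<open>-(n - 1)/(n + 1)\<close>. If the bound is attained, then all
  \<open>\<lambda>\<^sub>v(-v)\<close> equal this average and \<open>-v\<close> minimises \<open>\<lambda>\<^sub>v\<close> on the ball; the gradient of \<open>\<lambda>\<^sub>v\<close> is then
  \<open>n/(n + 1) v\<close> with \<open>v\<close> a unit vector, and \<open>\<lambda>\<^sub>v(w) = 0\<close> reads \<open>v \<bullet> w = -1/n\<close>: the simplex is regular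
  and inscribed (\<open>regular_inscribed_if_minimal\<close>).

  For a regular inscribed simplex the coordinates satisfy \<open>\<Sum>\<^sub>v \<lambda>\<^sub>v(x)\<^sup>2 \<le> 1\<close> on the ball. Among
  vectors with sum \<open>1\<close> and Euclidean length at most \<open>1\<close>, the sum of absolute values is largest when
  the negative entries coincide and the others coincide too; if there are at most five entries, then
  one negative entry is the best choice, which gives exactly \<open>(3n - 1)/(n + 1)\<close>
  (\<open>sum_abs_le_if_sum_squares_le\<close>). This is where \<open>n \<le> 4\<close> enters.
\<close>

section \<open>Barycentric coordinates\<close>

text \<open>
  A node set together with its barycentric coordinates, given by gradients \<open>g\<close> and values \<open>c\<close> at the
  centre of the ball. Duality alone forces affine independence, so the locale covers both an
  arbitrary simplex and one given by explicit coordinates.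
\<close>

locale barycentric_coordinates =
  fixes V :: "(real ^ 'n) set" and g :: "real ^ 'n \<Rightarrow> real ^ 'n" and c :: "real ^ 'n \<Rightarrow> real"
  assumes finite_nodes: "finite V"
    and card_nodes: "card V = CARD('n) + 1"
    and dual: "v \<in> V \<Longrightarrow> w \<in> V \<Longrightarrow> g v \<bullet> w + c v = (if v = w then 1 else 0)"
begin

definition lam :: "real ^ 'n \<Rightarrow> real ^ 'n \<Rightarrow> real" where
  "lam v x = g v \<bullet> x + c v"

lemma lam_node: "v \<in> V \<Longrightarrow> w \<in> V \<Longrightarrow> lam v w = (if v = w then 1 else 0)"
  using dual by (simp add: lam_def)

lemma affinely_independent: "\<not> affine_dependent V"
proof
  assume "affine_dependent V"
  then obtain U where U: "sum U V = 0" "(\<Sum>v\<in>V. U v *\<^sub>R v) = 0" and "\<exists>v\<in>V. U v \<noteq> 0"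
    using affine_dependent_explicit_finite[OF finite_nodes] by auto
  then obtain v where v: "v \<in> V" "U v \<noteq> 0" by blast
  have "(\<Sum>w\<in>V. U w * lam v w) = g v \<bullet> (\<Sum>w\<in>V. U w *\<^sub>R w) + c v * sum U V"
    by (simp add: lam_def inner_sum_right sum_distrib_left sum.distrib algebra_simps)
  moreover have "(\<Sum>w\<in>V. U w * lam v w) = (\<Sum>w\<in>V. if v = w then U w else 0)"
    using v by (intro sum.cong) (auto simp: lam_node)
  ultimately show False
    using U v finite_nodes by simp
qed

lemma affine_hull_nodes: "affine hull V = UNIV"
  by (rule affine_independent_span_eq[OF affinely_independent]) (simp add: card_nodes)

lemma simplex_nodes: "int CARD('n) simplex (convex hull V)"
  unfolding simplex_def using affinely_independent card_nodes by auto

lemma vertices_nodes: "vertices (convex hull V) = V"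
  unfolding vertices_def
  using extreme_point_of_convex_hull_affine_independent[OF affinely_independent] by auto

lemma affine_function_eq_if_eq_on_nodes:
  assumes "\<And>v. v \<in> V \<Longrightarrow> a \<bullet> v + r = b \<bullet> v + s"
  shows "a \<bullet> x + r = b \<bullet> x + s"
proof -
  have "affine hull V \<subseteq> {x. (a - b) \<bullet> x = s - r}"
  proof (rule hull_minimal)
    show "V \<subseteq> {x. (a - b) \<bullet> x = s - r}"
      using assms by (force simp: inner_diff_left)
  qed (rule affine_hyperplane)
  then have "(a - b) \<bullet> x = s - r"
    using affine_hull_nodes by auto
  then show ?thesis by (simp add: inner_diff_left)
qed

text \<open>Lagrange interpolation: both sides are affine in \<open>x\<close> and agree at the nodes.\<close>

lemma affine_function_eq_sum_lam:
  "a \<bullet> x + r = (\<Sum>v\<in>V. (a \<bullet> v + r) * lam v x)"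
proof -
  have comb: "(\<Sum>v\<in>V. (a \<bullet> v + r) * lam v y)
      = (\<Sum>v\<in>V. (a \<bullet> v + r) *\<^sub>R g v) \<bullet> y + (\<Sum>v\<in>V. (a \<bullet> v + r) * c v)" for y
    by (simp add: lam_def inner_sum_left sum.distrib algebra_simps)
  have node: "(\<Sum>v\<in>V. (a \<bullet> v + r) * lam v w) = a \<bullet> w + r" if "w \<in> V" for w
  proof -
    have "(\<Sum>v\<in>V. (a \<bullet> v + r) * lam v w) = (\<Sum>v\<in>V. if v = w then a \<bullet> v + r else 0)"
      using that by (intro sum.cong) (auto simp: lam_node)
    then show ?thesis using that finite_nodes by simp
  qed
  show ?thesis
    unfolding comb by (rule affine_function_eq_if_eq_on_nodes) (use node comb in simp)
qed

lemma sum_lam: "(\<Sum>v\<in>V. lam v x) = 1"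
  using affine_function_eq_sum_lam[of 0 x 1] by simp

lemma projector_eq_sum_lam:
  assumes "interpolation_projector (convex hull V) P" "f \<in> cont_ball"
  shows "P f x = (\<Sum>v\<in>V. f v * lam v x)"
proof -
  obtain a r where ar: "P f = (\<lambda>x. a \<bullet> x + r)"
    using assms unfolding interpolation_projector_def linear_polys_def by blast
  have "a \<bullet> v + r = f v" if "v \<in> V" for v
    using assms that fun_cong[OF ar, of v]
    unfolding interpolation_projector_def vertices_nodes by auto
  then show ?thesis
    using affine_function_eq_sum_lam[of a x r] by (simp add: ar)
qed

lemma interpolation_projector_exists:
  "interpolation_projector (convex hull V) (\<lambda>f x. \<Sum>v\<in>V. f v * lam v x)"
  unfolding interpolation_projector_def vertices_nodes
proof (intro ballI conjI)
  fix f :: "real ^ 'n \<Rightarrow> real" and w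
  have "(\<lambda>x. \<Sum>v\<in>V. f v * lam v x)
      = (\<lambda>x. (\<Sum>v\<in>V. f v *\<^sub>R g v) \<bullet> x + (\<Sum>v\<in>V. f v * c v))"
    by (simp add: lam_def inner_sum_left sum.distrib algebra_simps)
  then show "(\<lambda>x. \<Sum>v\<in>V. f v * lam v x) \<in> linear_polys"
    unfolding linear_polys_def by blast
  assume "w \<in> V"
  then have "(\<Sum>v\<in>V. f v * lam v w) = (\<Sum>v\<in>V. if v = w then f v else 0)"
    by (intro sum.cong) (auto simp: lam_node)
  then show "(\<Sum>v\<in>V. f v * lam v w) = f w"
    using \<open>w \<in> V\<close> finite_nodes by simp
qed

end

text \<open>
  Moving a second vertex to the origin turns the remaining vertices into linearly independent
  vectors, on which a linear functional may be prescribed.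
\<close>

lemma affine_independent_dual_function:
  fixes V :: "'a::euclidean_space set"
  assumes "\<not> affine_dependent V" "v \<in> V" "u \<in> V" "u \<noteq> v"
  shows "\<exists>a r. \<forall>w\<in>V. a \<bullet> w + r = (if v = w then 1 else (0::real))"
proof -
  let ?B = "(\<lambda>x. -u + x) ` (V - {u})"
  have "independent ?B"
    using affine_dependent_iff_dependent2[OF \<open>u \<in> V\<close>] assms by auto
  then obtain h :: "'a \<Rightarrow> real" where h: "linear h"
      "\<And>x. x \<in> ?B \<Longrightarrow> h x = (if x = - u + v then 1 else 0)"
    using linear_independent_extend[of ?B "\<lambda>x. if x = - u + v then 1 else 0"] by blast
  have "adjoint h 1 \<bullet> w + (- h u) = (if v = w then 1 else 0)" if "w \<in> V" for w
  proof -
    have "adjoint h 1 \<bullet> w + (- h u) = h (- u + w)"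
      using adjoint_works[OF h(1), of w 1] linear_diff[OF h(1), of w u] by (simp add: inner_commute)
    moreover have "h (- u + w) = (if v = w then 1 else 0)"
    proof (cases "w = u")
      case True
      then show ?thesis using linear_0[OF h(1)] assms by simp
    next
      case False
      then show ?thesis using that by (subst h(2)) auto
    qed
    ultimately show ?thesis by simp
  qed
  then show ?thesis by blast
qed

lemma simplex_barycentric_coordinates:
  fixes S :: "(real ^ 'n) set"
  assumes "int CARD('n) simplex S"
  obtains V g c where "barycentric_coordinates V g c" "S = convex hull V"
proof -
  obtain V where V: "\<not> affine_dependent V" "int (card V) = int CARD('n) + 1" "S = convex hull V"
    using assms unfolding simplex_def by blast
  have card: "card V = CARD('n) + 1" using V by linarith
  then have fin: "finite V" by (metis add_is_0 card.infinite one_neq_zero)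
  have "\<exists>a r. \<forall>w\<in>V. a \<bullet> w + r = (if v = w then 1 else (0::real))" if "v \<in> V" for v
  proof -
    have "card (V - {v}) = CARD('n)" using card that fin by simp
    then have "V - {v} \<noteq> {}" by (metis card.empty zero_less_card_finite less_irrefl)
    then obtain u where "u \<in> V" "u \<noteq> v" by auto
    then show ?thesis using affine_independent_dual_function[OF V(1) that] by blast
  qed
  then obtain g c where "\<forall>v\<in>V. \<forall>w\<in>V. g v \<bullet> w + c v = (if v = w then 1 else (0::real))"
    by metis
  then have "barycentric_coordinates V g c"
    using fin card by unfold_locales auto
  then show ?thesis using that V by blast
qed

section \<open>The norm of a projector in terms of barycentric coordinates\<close>

lemma abs_le_max_norm:
  assumes "f \<in> cont_ball" "x \<in> unit_cball"
  shows "\<bar>f x\<bar> \<le> max_norm f"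
  unfolding max_norm_def
proof (rule cSUP_upper[OF assms(2)])
  have "continuous_on unit_cball (\<lambda>x. \<bar>f x\<bar>)"
    using assms by (auto simp: cont_ball_def intro!: continuous_intros)
  then have "compact ((\<lambda>x. \<bar>f x\<bar>) ` unit_cball)"
    by (rule compact_continuous_image) simp
  then show "bdd_above ((\<lambda>x. \<bar>f x\<bar>) ` unit_cball)"
    by (intro bounded_imp_bdd_above compact_imp_bounded)
qed

lemma max_norm_le:
  assumes "\<And>x. x \<in> unit_cball \<Longrightarrow> \<bar>f x\<bar> \<le> M"
  shows "max_norm f \<le> M"
  unfolding max_norm_def by (rule cSUP_least) (use assms in auto)

lemma linear_polys_subset_cont_ball: "linear_polys \<subseteq> cont_ball"
  by (auto simp: linear_polys_def cont_ball_def intro!: continuous_intros)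

locale nodes_in_ball = barycentric_coordinates V g c
  for V :: "(real ^ 'n) set" and g c +
  assumes nodes_subset: "V \<subseteq> unit_cball"
begin

lemma simplex_with_nodes: "simplex_with_nodes_in_ball (convex hull V)"
  unfolding simplex_with_nodes_in_ball_def vertices_nodes
  using simplex_nodes nodes_subset by blast

context
  fixes P
  assumes projector: "interpolation_projector (convex hull V) P"
begin

lemma max_norm_projector_le:
  assumes "f \<in> cont_ball" "max_norm f \<le> 1"
    and "\<And>x. x \<in> unit_cball \<Longrightarrow> (\<Sum>v\<in>V. \<bar>lam v x\<bar>) \<le> M"
  shows "max_norm (P f) \<le> M"
proof (rule max_norm_le)
  fix x :: "real ^ 'n" assume x: "x \<in> unit_cball"
  have "\<bar>P f x\<bar> \<le> (\<Sum>v\<in>V. \<bar>f v * lam v x\<bar>)"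
    unfolding projector_eq_sum_lam[OF projector assms(1)] by (rule sum_abs)
  also have "\<dots> \<le> (\<Sum>v\<in>V. \<bar>lam v x\<bar>)"
  proof (rule sum_mono)
    fix v assume "v \<in> V"
    then have "\<bar>f v\<bar> \<le> 1"
      using abs_le_max_norm[OF assms(1), of v] nodes_subset assms(2) by force
    then show "\<bar>f v * lam v x\<bar> \<le> \<bar>lam v x\<bar>"
      by (simp add: abs_mult mult_left_le_one_le)
  qed
  also have "\<dots> \<le> M" using assms(3)[OF x] .
  finally show "\<bar>P f x\<bar> \<le> M" .
qed

lemma op_norm_le:
  assumes "\<And>x. x \<in> unit_cball \<Longrightarrow> (\<Sum>v\<in>V. \<bar>lam v x\<bar>) \<le> M"
  shows "op_norm P \<le> M"
  unfolding op_norm_def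
proof (rule cSUP_least)
  have "(\<lambda>x. 0) \<in> {f \<in> cont_ball. max_norm f \<le> 1}"
    by (auto simp: cont_ball_def intro!: max_norm_le)
  then show "{f \<in> cont_ball. max_norm f \<le> 1} \<noteq> {}" by blast
qed (use assms in \<open>auto intro: max_norm_projector_le\<close>)

lemma max_norm_projector_le_op_norm:
  assumes "f \<in> cont_ball" "max_norm f \<le> 1"
  shows "max_norm (P f) \<le> op_norm P"
  unfolding op_norm_def
proof (rule cSUP_upper)
  let ?M = "\<Sum>v\<in>V. norm (g v) + \<bar>c v\<bar>"
  have "(\<Sum>v\<in>V. \<bar>lam v x\<bar>) \<le> ?M" if x: "x \<in> unit_cball" for x
  proof (rule sum_mono)
    fix v
    have "\<bar>g v \<bullet> x\<bar> \<le> norm (g v) * norm x" by (rule Cauchy_Schwarz_ineq2)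
    also have "\<dots> \<le> norm (g v)" using x by (simp add: mult_left_le)
    finally show "\<bar>lam v x\<bar> \<le> norm (g v) + \<bar>c v\<bar>" unfolding lam_def by linarith
  qed
  then show "bdd_above ((\<lambda>f. max_norm (P f)) ` {f \<in> cont_ball. max_norm f \<le> 1})"
    by (auto intro!: bdd_aboveI2[where M = ?M] max_norm_projector_le)
qed (use assms in auto)

text \<open>
  The test function is \<open>-1\<close> at \<open>v\<close> and \<open>1\<close> at the other nodes; it exists by Urysohn's lemma.
\<close>

lemma one_minus_lam_le_op_norm:
  assumes "v \<in> V" "x \<in> unit_cball"
  shows "1 - 2 * lam v x \<le> op_norm P"
proof -
  have "closed {v}" "closed (V - {v})" "{v} \<inter> (V - {v}) = {}"
    using finite_nodes by (auto intro: finite_imp_closed)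
  then obtain f :: "real ^ 'n \<Rightarrow> real" where f: "continuous_on UNIV f"
      "\<And>x. f x \<in> closed_segment (-1) 1" "\<And>x. x \<in> {v} \<Longrightarrow> f x = -1"
      "\<And>x. x \<in> V - {v} \<Longrightarrow> f x = 1"
    by (rule Urysohn) blast
  have cont: "f \<in> cont_ball"
    using continuous_on_subset[OF f(1)] by (auto simp: cont_ball_def)
  have bound: "max_norm f \<le> 1"
  proof (rule max_norm_le)
    fix x show "\<bar>f x\<bar> \<le> 1" using f(2)[of x] by (auto simp: closed_segment_eq_real_ivl)
  qed
  have "1 - 2 * lam v x = (\<Sum>w\<in>V. lam w x) - 2 * lam v x"
    by (simp add: sum_lam)
  also have "\<dots> = (\<Sum>w\<in>V. f w * lam w x)"
    using f(3,4) assms(1) finite_nodes by (simp add: sum.remove)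
  also have "\<dots> = P f x"
    by (simp add: projector_eq_sum_lam[OF projector cont])
  also have "\<dots> \<le> max_norm (P f)"
  proof -
    have "P f \<in> cont_ball"
      using projector cont linear_polys_subset_cont_ball
      unfolding interpolation_projector_def by blast
    then show ?thesis using abs_le_max_norm[of "P f" x] assms(2) by linarith
  qed
  also have "\<dots> \<le> op_norm P"
    by (rule max_norm_projector_le_op_norm[OF cont bound])
  finally show ?thesis .
qed

section \<open>The lower bound and its equality case\<close>

text \<open>
  The centre is the midpoint of \<open>v\<close> and \<open>-v\<close>, so \<open>c v\<close> is the mean of \<open>\<lambda>\<^sub>v(v) = 1\<close> and \<open>\<lambda>\<^sub>v(-v)\<close>.
\<close>

lemma lam_centre_ge:
  assumes "v \<in> V"
  shows "(3 - op_norm P) / 4 \<le> c v"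
proof -
  have "- v \<in> unit_cball" using assms nodes_subset by auto
  from one_minus_lam_le_op_norm[OF assms this] show ?thesis
    using dual[OF assms assms] by (simp add: lam_def)
qed

lemma sum_lam_centre: "(\<Sum>v\<in>V. c v) = 1"
  using sum_lam[of 0] by (simp add: lam_def)

theorem op_norm_ge: "(3 * real CARD('n) - 1) / (real CARD('n) + 1) \<le> op_norm P"
proof -
  have "real (card V) * ((3 - op_norm P) / 4) \<le> (\<Sum>v\<in>V. c v)"
    by (rule sum_bounded_below) (rule lam_centre_ge)
  then show ?thesis
    by (simp add: sum_lam_centre card_nodes field_simps)
qed

text \<open>
  At equality each \<open>c v\<close> equals its lower bound, because the lower bounds already add up to \<open>1\<close>.
\<close>

lemma lam_centre_if_minimal:
  assumes "op_norm P = (3 * real CARD('n) - 1) / (real CARD('n) + 1)" "v \<in> V"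
  shows "c v = 1 / (real CARD('n) + 1)"
proof -
  let ?b = "1 / (real CARD('n) + 1)"
  have b: "(3 - op_norm P) / 4 = ?b"
    unfolding assms(1) by (simp add: field_simps)
  have ge: "\<And>w. w \<in> V \<Longrightarrow> 0 \<le> c w - ?b"
    using lam_centre_ge b by simp
  have "(\<Sum>w\<in>V. c w - ?b) = 0"
    by (simp add: sum_subtractf sum_lam_centre card_nodes add.commute)
  then have "c v - ?b = 0"
    using sum_nonneg_eq_0_iff[OF finite_nodes, of "\<lambda>w. c w - ?b"] ge assms(2) by simp
  then show ?thesis by simp
qed

text \<open>
  The minimum \<open>c v - norm (g v)\<close> of \<open>\<lambda>\<^sub>v\<close> on the ball is attained at \<open>-v\<close>, so the Cauchy-Schwarz
  inequality for \<open>g v\<close> and \<open>v\<close> is an equality.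
\<close>

lemma gradient_if_minimal:
  assumes minimal: "op_norm P = (3 * real CARD('n) - 1) / (real CARD('n) + 1)" and v: "v \<in> V"
  shows "g v = (real CARD('n) / (real CARD('n) + 1)) *\<^sub>R v" "norm v = 1"
proof -
  define n where "n = real CARD('n)"
  define k where "k = n / (n + 1)"
  have n: "n > 0" by (simp add: n_def)
  have k: "k > 0" using n by (simp add: k_def)
  have c: "c v = 1 - k"
    using lam_centre_if_minimal[OF assms] n by (simp add: n_def[symmetric] k_def field_simps)
  have gv: "g v \<bullet> v = k" using dual[OF v v] c by simp
  have "norm (g v) \<le> k"
  proof (cases "g v = 0")
    case True then show ?thesis using k by simp
  next
    case False
    \<comment> \<open>Evaluate \<open>\<lambda>\<^sub>v\<close> at its minimum point on the ball.\<close>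
    let ?x = "- (g v /\<^sub>R norm (g v))"
    have "?x \<in> unit_cball" using False by simp
    from one_minus_lam_le_op_norm[OF v this]
    have "1 - 2 * (c v - norm (g v)) \<le> op_norm P"
      using False by (simp add: lam_def dot_square_norm power2_eq_square mult.assoc[symmetric])
    moreover have "op_norm P = 1 + 2 * (2 * k - 1)"
      using n by (simp add: minimal n_def[symmetric] k_def field_simps)
    ultimately show ?thesis using c by simp
  qed
  then have g2: "g v \<bullet> g v \<le> k\<^sup>2"
    using power_mono[of "norm (g v)" k 2] by (simp add: dot_square_norm)
  have v2: "v \<bullet> v \<le> 1"
    using v nodes_subset power_mono[of "norm v" 1 2] by (force simp: dot_square_norm)
  have "(g v - k *\<^sub>R v) \<bullet> (g v - k *\<^sub>R v) = g v \<bullet> g v - 2 * k * (g v \<bullet> v) + k\<^sup>2 * (v \<bullet> v)"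
    by (simp add: inner_diff_left inner_diff_right inner_commute power2_eq_square algebra_simps)
  also have "\<dots> \<le> k\<^sup>2 - 2 * k * k + k\<^sup>2 * 1"
    unfolding gv using g2 v2 k by (intro add_mono diff_mono mult_left_mono) auto
  also have "\<dots> = 0" by (simp add: power2_eq_square)
  finally have "(g v - k *\<^sub>R v) \<bullet> (g v - k *\<^sub>R v) \<le> 0" .
  then have g: "g v = k *\<^sub>R v"
    by (metis inner_gt_zero_iff not_le right_minus_eq)
  then show "g v = (real CARD('n) / (real CARD('n) + 1)) *\<^sub>R v"
    by (simp add: k_def n_def)
  have "v \<bullet> v = 1" using gv k unfolding g by simp
  then show "norm v = 1" by (simp add: norm_eq_1)
qed

theorem regular_inscribed_if_minimal:
  assumes minimal: "op_norm P = (3 * real CARD('n) - 1) / (real CARD('n) + 1)"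
  shows "regular_simplex (convex hull V)" "inscribed (convex hull V)"
proof -
  show "inscribed (convex hull V)"
    unfolding inscribed_def vertices_nodes using gradient_if_minimal(2)[OF minimal] by auto
  have "dist v w = sqrt (2 + 2 / real CARD('n))" if vw: "v \<in> V" "w \<in> V" "v \<noteq> w" for v w
  proof -
    have "real CARD('n) / (real CARD('n) + 1) * (v \<bullet> w) + 1 / (real CARD('n) + 1) = 0"
      using dual[OF vw(1,2)] vw(3) gradient_if_minimal(1)[OF minimal vw(1)]
        lam_centre_if_minimal[OF minimal vw(1)] by simp
    then have "real CARD('n) * (v \<bullet> w) + 1 = 0"
      by (simp add: add_divide_distrib[symmetric] add_eq_0_iff2 del: of_nat_add)
    then have "v \<bullet> w = - (1 / real CARD('n))"
      by (simp add: field_simps)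
    moreover have "v \<bullet> v = 1" "w \<bullet> w = 1"
      using gradient_if_minimal(2)[OF minimal] vw by (auto simp: norm_eq_1)
    ultimately show ?thesis
      by (simp add: dist_norm norm_eq_sqrt_inner inner_diff_left inner_diff_right inner_commute)
  qed
  then show "regular_simplex (convex hull V)"
    unfolding regular_simplex_def vertices_nodes using simplex_nodes by blast
qed

end

end

section \<open>Optimality of the regular simplex\<close>

text \<open>
  Here \<open>m\<close> negative entries of total \<open>-s\<close> and \<open>p\<close> others of total \<open>1 + s\<close> are compared with the case
  \<open>m = 1\<close>, where the hypothesis becomes \<open>s \<le> (p - 1)/(p + 1)\<close>. For \<open>p + m > 5\<close> the comparison can fail.
\<close>

lemma negative_mass_le:
  fixes s :: real and p m :: nat
  assumes "p + m \<le> 5" "1 \<le> p" "1 \<le> m" "0 \<le> s"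
    and le: "p * s\<^sup>2 + m * (1 + s)\<^sup>2 \<le> p * m"
  shows "s \<le> (real (p + m) - 2) / real (p + m)"
proof (rule ccontr)
  assume *: "\<not> ?thesis"
  define q where "q = (real (p + m) - 2) / real (p + m)"
  have "0 \<le> q" using assms by (simp add: q_def)
  have sq: "s > q" using * by (simp add: q_def)
  \<comment> \<open>With a name for \<open>s\<^sup>2\<close> the contradiction is linear in each of the finitely many cases.\<close>
  define t where "t = s\<^sup>2"
  have t: "t > q\<^sup>2" unfolding t_def using sq \<open>0 \<le> q\<close> by (simp add: power_strict_mono)
  have le': "p * t + m * (1 + 2 * s + t) \<le> p * m"
    using le by (simp add: t_def power2_eq_square algebra_simps)
  have "p \<in> {1,2,3,4}" "m \<in> {1,2,3,4}" using assms by auto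
  then show False
    using assms(1) le' sq t by (auto simp: q_def power2_eq_square)
qed

text \<open>
  Splitting by sign and applying the Cauchy-Schwarz inequality to each part leaves only the numbers
  of negative and nonnegative entries and the total of the negative ones.
\<close>

lemma sum_abs_le_if_sum_squares_le:
  fixes y :: "'a \<Rightarrow> real"
  assumes "finite V" "card V = n + 1" "1 \<le> n" "n \<le> 4"
    and sum: "sum y V = 1" and squares: "(\<Sum>v\<in>V. (y v)\<^sup>2) \<le> 1"
  shows "(\<Sum>v\<in>V. \<bar>y v\<bar>) \<le> (3 * real n - 1) / (real n + 1)"
proof -
  define A where "A = {v\<in>V. y v < 0}"
  define B where "B = {v\<in>V. 0 \<le> y v}"
  have AB: "V = A \<union> B" "A \<inter> B = {}" "finite A" "finite B"
    using assms(1) by (auto simp: A_def B_def)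
  define s where "s = - sum y A"
  have s0: "0 \<le> s"
    unfolding s_def A_def by (auto intro!: sum_nonpos)
  have sB: "sum y B = 1 + s"
    using sum AB by (simp add: sum.union_disjoint s_def)
  have "(\<Sum>v\<in>V. \<bar>y v\<bar>) = (\<Sum>v\<in>A. \<bar>y v\<bar>) + (\<Sum>v\<in>B. \<bar>y v\<bar>)"
    using AB by (simp add: sum.union_disjoint)
  also have "(\<Sum>v\<in>A. \<bar>y v\<bar>) = (\<Sum>v\<in>A. - y v)" by (rule sum.cong) (auto simp: A_def)
  also have "(\<Sum>v\<in>B. \<bar>y v\<bar>) = (\<Sum>v\<in>B. y v)" by (rule sum.cong) (auto simp: B_def)
  finally have abs: "(\<Sum>v\<in>V. \<bar>y v\<bar>) = 1 + 2 * s"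
    using sB by (simp add: s_def sum_negf)
  have "s \<le> (real n - 1) / (real n + 1)"
  proof (cases "A = {}")
    case True
    then show ?thesis using assms(3) by (simp add: s_def)
  next
    case False
    let ?a = "\<Sum>v\<in>A. (y v)\<^sup>2" and ?b = "\<Sum>v\<in>B. (y v)\<^sup>2"
    have "B \<noteq> {}" using sB s0 by auto
    then have pos: "1 \<le> card A" "1 \<le> card B"
      using False AB by (auto simp: Suc_leI card_gt_0_iff)
    have cards: "card B + card A = n + 1"
      using assms(2) AB card_Un_disjoint[of A B] by simp
    have "s\<^sup>2 \<le> ?a * card A" "(1 + s)\<^sup>2 \<le> ?b * card B"
      using sum_squared_le_sum_of_squares[of y A] sum_squared_le_sum_of_squares[of y B] sB
      by (simp_all add: s_def)
    then have "card B * s\<^sup>2 + card A * (1 + s)\<^sup>2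
        \<le> card B * (?a * card A) + card A * (?b * card B)"
      by (intro add_mono mult_left_mono) auto
    also have "\<dots> = (card B * card A) * (\<Sum>v\<in>V. (y v)\<^sup>2)"
      using AB by (simp add: sum.union_disjoint algebra_simps)
    also have "\<dots> \<le> card B * card A"
      using squares by (simp add: mult_left_le)
    finally have "s \<le> (real (card B + card A) - 2) / real (card B + card A)"
      using cards assms(4) pos s0 by (intro negative_mass_le) auto
    then show ?thesis unfolding cards by (simp add: add.commute)
  qed
  then have "1 + 2 * s \<le> 1 + 2 * ((real n - 1) / (real n + 1))" by linarith
  also have "\<dots> = (3 * real n - 1) / (real n + 1)" by (simp add: field_simps)
  finally show ?thesis by (simp add: abs)
qed

text \<open>
  Vertices of a regular simplex inscribed in the unit sphere: the standard basis, scaled by \<open>a\<close> and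
  translated along the diagonal by \<open>b\<close>, and a unit vector on the opposite half of the diagonal.
  The constants are the solution of the two equations that give the translated vectors length \<open>1\<close>
  and inner product \<open>-1/n\<close> with the last one.
\<close>

context
  fixes a b :: real and z :: "'n::finite option \<Rightarrow> real ^ 'n"
  defines "a \<equiv> sqrt ((real CARD('n) + 1) / real CARD('n))"
    and "b \<equiv> (1 / sqrt (real CARD('n)) - a) / real CARD('n)"
    and "z \<equiv> (\<lambda>j. case j of None \<Rightarrow> - (1 / sqrt (real CARD('n))) *\<^sub>R 1
                         | Some i \<Rightarrow> a *\<^sub>R axis i 1 + b *\<^sub>R 1)"
begin

lemma inner_regular_vertex:
  "z None \<bullet> x = - (\<Sum>i\<in>UNIV. x $ i) / sqrt (real CARD('n))"
  "z (Some i) \<bullet> x = a * x $ i + b * (\<Sum>i\<in>UNIV. x $ i)"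
proof -
  have one: "(1 :: real ^ 'n) \<bullet> x = (\<Sum>i\<in>UNIV. x $ i)"
    by (simp add: inner_vec_def)
  show "z None \<bullet> x = - (\<Sum>i\<in>UNIV. x $ i) / sqrt (real CARD('n))"
    "z (Some i) \<bullet> x = a * x $ i + b * (\<Sum>i\<in>UNIV. x $ i)"
    by (simp_all add: z_def one inner_add_left inner_axis')
qed

lemma regular_constants:
  "a\<^sup>2 = 1 + 1 / real CARD('n)"
  "2 * a * b + real CARD('n) * b\<^sup>2 = - 1 / real CARD('n)"
  "a + real CARD('n) * b = 1 / sqrt (real CARD('n))"
proof -
  define n where "n = real CARD('n)"
  have n: "n > 0" by (simp add: n_def)
  show a2: "a\<^sup>2 = 1 + 1 / real CARD('n)"
    using n by (simp add: a_def n_def[symmetric] field_simps)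
  show ab: "a + real CARD('n) * b = 1 / sqrt (real CARD('n))"
    using n by (simp add: b_def n_def[symmetric])
  have "n * (2 * a * b + n * b\<^sup>2) = (a + n * b)\<^sup>2 - a\<^sup>2"
    by (simp add: power2_eq_square algebra_simps)
  also have "\<dots> = - 1"
    using n unfolding n_def ab a2 by (simp add: power_divide)
  finally show "2 * a * b + real CARD('n) * b\<^sup>2 = - 1 / real CARD('n)"
    using n by (simp add: n_def[symmetric] field_simps)
qed

lemma sum_coordinates_regular_vertex:
  "(\<Sum>i\<in>UNIV. z None $ i) = - sqrt (real CARD('n))"
  "(\<Sum>i\<in>UNIV. z (Some j) $ i) = 1 / sqrt (real CARD('n))"
proof -
  show "(\<Sum>i\<in>UNIV. z None $ i) = - sqrt (real CARD('n))"
    by (simp add: z_def real_div_sqrt)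
  have "(\<Sum>i\<in>UNIV. z (Some j) $ i) = a + real CARD('n) * b"
    by (simp add: z_def axis_def sum.distrib if_distrib[of "\<lambda>t. a * t"] cong: if_cong)
  then show "(\<Sum>i\<in>UNIV. z (Some j) $ i) = 1 / sqrt (real CARD('n))"
    by (simp add: regular_constants)
qed

lemma inner_regular_vertices: "z j \<bullet> z k = (if j = k then 1 else - 1 / real CARD('n))"
proof -
  have SS: "z (Some i) \<bullet> z (Some l) = (if i = l then 1 else - 1 / real CARD('n))" for i l
  proof -
    have "z (Some i) \<bullet> z (Some l)
        = a\<^sup>2 * (if i = l then 1 else 0) + (a * b + b * (a + real CARD('n) * b))"
      unfolding inner_regular_vertex sum_coordinates_regular_vertex regular_constants(3)[symmetric]
      by (simp add: z_def axis_def power2_eq_square algebra_simps)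
    also have "a * b + b * (a + real CARD('n) * b) = 2 * a * b + real CARD('n) * b\<^sup>2"
      by (simp add: power2_eq_square algebra_simps)
    finally show ?thesis
      unfolding regular_constants by simp
  qed
  have NN: "z None \<bullet> z None = 1"
    unfolding inner_regular_vertex sum_coordinates_regular_vertex by simp
  have NS: "z None \<bullet> z (Some i) = - 1 / real CARD('n)" for i
    unfolding inner_regular_vertex sum_coordinates_regular_vertex by simp
  show ?thesis
    by (cases j; cases k) (auto simp: SS NN NS inner_commute[of "z (Some _)" "z None"])
qed

lemma sum_inner_regular_vertices: "(\<Sum>j\<in>UNIV. z j \<bullet> x) = 0"
proof -
  let ?s = "\<Sum>i\<in>UNIV. x $ i"
  have "(\<Sum>j\<in>UNIV. z j \<bullet> x) = z None \<bullet> x + (\<Sum>i\<in>UNIV. z (Some i) \<bullet> x)"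
    by (simp add: UNIV_option_conv sum.reindex)
  also have "\<dots> = ?s * (a + real CARD('n) * b - 1 / sqrt (real CARD('n)))"
    by (simp add: inner_regular_vertex sum.distrib sum_distrib_left[symmetric] algebra_simps)
  finally show ?thesis by (simp add: regular_constants)
qed

lemma sum_squares_inner_regular_vertices:
  "(\<Sum>j\<in>UNIV. (z j \<bullet> x)\<^sup>2) = (1 + 1 / real CARD('n)) * (norm x)\<^sup>2"
proof -
  let ?s = "\<Sum>i\<in>UNIV. x $ i"
  have "(\<Sum>j\<in>UNIV. (z j \<bullet> x)\<^sup>2) = (z None \<bullet> x)\<^sup>2 + (\<Sum>i\<in>UNIV. (z (Some i) \<bullet> x)\<^sup>2)"
    by (simp add: UNIV_option_conv sum.reindex)
  also have "(\<Sum>i\<in>UNIV. (z (Some i) \<bullet> x)\<^sup>2)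
      = (\<Sum>i\<in>UNIV. a\<^sup>2 * (x $ i)\<^sup>2 + (2 * a * b * ?s) * x $ i + b\<^sup>2 * ?s\<^sup>2)"
    unfolding inner_regular_vertex
    by (rule sum.cong) (auto simp: power2_eq_square algebra_simps)
  also have "\<dots> = a\<^sup>2 * (\<Sum>i\<in>UNIV. (x $ i)\<^sup>2) + (2 * a * b * ?s) * ?s
      + real CARD('n) * (b\<^sup>2 * ?s\<^sup>2)"
    by (simp add: sum.distrib sum_distrib_left[symmetric])
  also have "\<dots> = a\<^sup>2 * (norm x)\<^sup>2 + (2 * a * b + real CARD('n) * b\<^sup>2) * ?s\<^sup>2"
    by (simp add: power2_norm_eq_inner inner_vec_def power2_eq_square[of "_ $ _"])
       (simp add: power2_eq_square algebra_simps)
  also have "(z None \<bullet> x)\<^sup>2 = ?s\<^sup>2 / real CARD('n)"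
    by (simp add: inner_regular_vertex power_divide)
  finally show ?thesis
    unfolding regular_constants by simp
qed

lemma inj_regular_vertex: "inj z"
proof (rule injI)
  fix j k assume "z j = z k"
  then have "z j \<bullet> z k = 1" using inner_regular_vertices[of k k] by simp
  then show "j = k"
    using inner_regular_vertices[of j k] by (auto simp: field_simps split: if_splits)
qed

lemma regular_simplex_coordinates:
  "nodes_in_ball (range z) (\<lambda>v. (real CARD('n) / (real CARD('n) + 1)) *\<^sub>R v)
     (\<lambda>_. 1 / (real CARD('n) + 1))"
proof unfold_locales
  show "finite (range z)" by simp
  show "card (range z) = CARD('n) + 1"
    using inj_regular_vertex by (simp add: card_image card_UNIV_option)
  show "(real CARD('n) / (real CARD('n) + 1)) *\<^sub>R v \<bullet> w + 1 / (real CARD('n) + 1)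
      = (if v = w then 1 else 0)" if "v \<in> range z" "w \<in> range z" for v w
    using that inj_regular_vertex
    by (auto simp: inner_regular_vertices inj_eq field_simps)
  show "range z \<subseteq> unit_cball"
    by (auto simp: norm_eq_sqrt_inner inner_regular_vertices)
qed

lemma sum_abs_regular_coordinates_le:
  assumes "CARD('n) \<le> 4" "x \<in> unit_cball"
  shows "(\<Sum>v\<in>range z. \<bar>(real CARD('n) / (real CARD('n) + 1)) *\<^sub>R v \<bullet> x + 1 / (real CARD('n) + 1)\<bar>)
    \<le> (3 * real CARD('n) - 1) / (real CARD('n) + 1)"
proof -
  define n where "n = real CARD('n)"
  have n: "n > 0" by (simp add: n_def)
  define y where "y j = (n * (z j \<bullet> x) + 1) / (n + 1)" for j
  have card: "card (UNIV :: 'n option set) = CARD('n) + 1"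
    by (simp add: card_UNIV_option)
  have "(norm x)\<^sup>2 \<le> 1" using assms(2) power_mono[of "norm x" 1 2] by simp
  have "sum y UNIV = (n * (\<Sum>j\<in>UNIV. z j \<bullet> x) + (n + 1)) / (n + 1)"
    unfolding y_def sum_divide_distrib[symmetric]
    by (simp add: sum.distrib sum_distrib_left card n_def)
  then have sum: "sum y UNIV = 1"
    using n by (simp add: sum_inner_regular_vertices)
  have "(\<Sum>j\<in>UNIV. (y j)\<^sup>2)
      = (\<Sum>j\<in>UNIV. n\<^sup>2 * (z j \<bullet> x)\<^sup>2 + 2 * n * (z j \<bullet> x) + 1) / (n + 1)\<^sup>2"
    unfolding y_def sum_divide_distrib
    by (intro sum.cong) (auto simp: power_divide power2_eq_square algebra_simps)
  also have "(\<Sum>j\<in>UNIV. n\<^sup>2 * (z j \<bullet> x)\<^sup>2 + 2 * n * (z j \<bullet> x) + 1)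
      = n\<^sup>2 * ((1 + 1 / n) * (norm x)\<^sup>2) + (n + 1)"
    by (simp add: sum.distrib sum_distrib_left[symmetric] sum_squares_inner_regular_vertices
        sum_inner_regular_vertices card n_def)
  also have "n\<^sup>2 * ((1 + 1 / n) * (norm x)\<^sup>2) \<le> n\<^sup>2 * ((1 + 1 / n) * 1)"
    using n \<open>(norm x)\<^sup>2 \<le> 1\<close> by (intro mult_left_mono) auto
  also have "(n\<^sup>2 * ((1 + 1 / n) * 1) + (n + 1)) / (n + 1)\<^sup>2 = 1"
  proof -
    have "n\<^sup>2 * ((1 + 1 / n) * 1) + (n + 1) = (n + 1)\<^sup>2"
      using n by (simp add: field_simps power2_eq_square)
    then show ?thesis using n by simp
  qed
  finally have squares: "(\<Sum>j\<in>UNIV. (y j)\<^sup>2) \<le> 1"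
    by (simp add: divide_right_mono)
  have "(\<Sum>v\<in>range z. \<bar>(real CARD('n) / (real CARD('n) + 1)) *\<^sub>R v \<bullet> x + 1 / (real CARD('n) + 1)\<bar>)
      = (\<Sum>j\<in>UNIV. \<bar>y j\<bar>)"
    using inj_regular_vertex
    by (simp add: sum.reindex y_def n_def add_divide_distrib)
  also have "\<dots> \<le> (3 * real CARD('n) - 1) / (real CARD('n) + 1)"
    by (rule sum_abs_le_if_sum_squares_le[OF _ card _ assms(1) sum squares]) (auto simp: Suc_leI)
  finally show ?thesis .
qed

lemma minimal_projector_exists:
  assumes "CARD('n) \<le> 4"
  shows "\<exists>(S :: (real ^ 'n) set) P. simplex_with_nodes_in_ball S \<and> interpolation_projector S P \<and>
    op_norm P = (3 * real CARD('n) - 1) / (real CARD('n) + 1)"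
proof -
  interpret nodes_in_ball "range z" "\<lambda>v. (real CARD('n) / (real CARD('n) + 1)) *\<^sub>R v"
    "\<lambda>_. 1 / (real CARD('n) + 1)"
    by (rule regular_simplex_coordinates)
  have "op_norm (\<lambda>f x. \<Sum>v\<in>range z. f v * lam v x)
      \<le> (3 * real CARD('n) - 1) / (real CARD('n) + 1)"
    using sum_abs_regular_coordinates_le[OF assms]
    by (intro op_norm_le[OF interpolation_projector_exists]) (simp only: lam_def)
  then show ?thesis
    using op_norm_ge[OF interpolation_projector_exists] simplex_with_nodes
      interpolation_projector_exists by (blast intro: antisym)
qed

end

section \<open>The minimal norm\<close>

lemma simplex_in_ball_coordinates:
  fixes S :: "(real ^ 'n) set"
  assumes "simplex_with_nodes_in_ball S"
  obtains V g c where "nodes_in_ball V g c" "S = convex hull V"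
proof -
  obtain V g c where V: "barycentric_coordinates V g c" "S = convex hull V"
    using assms simplex_barycentric_coordinates unfolding simplex_with_nodes_in_ball_def by metis
  then have "V \<subseteq> unit_cball"
    using assms barycentric_coordinates.vertices_nodes[OF V(1)]
    unfolding simplex_with_nodes_in_ball_def by simp
  then show ?thesis
    using V that nodes_in_ball.intro nodes_in_ball_axioms.intro by blast
qed

lemma theta_eq:
  assumes "CARD('n::finite) \<le> 4"
  shows "theta TYPE('n) = (3 * real CARD('n) - 1) / (real CARD('n) + 1)"
  unfolding theta_def
proof (rule cInf_eq_minimum)
  show "(3 * real CARD('n) - 1) / (real CARD('n) + 1)
      \<in> {op_norm P |(P :: (real ^ 'n \<Rightarrow> real) \<Rightarrow> (real ^ 'n \<Rightarrow> real)) S.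
            simplex_with_nodes_in_ball S \<and> interpolation_projector S P}"
    using minimal_projector_exists[OF assms] by (clarsimp, metis)
next
  fix t
  assume "t \<in> {op_norm P |(P :: (real ^ 'n \<Rightarrow> real) \<Rightarrow> (real ^ 'n \<Rightarrow> real)) S.
            simplex_with_nodes_in_ball S \<and> interpolation_projector S P}"
  then obtain P and S :: "(real ^ 'n) set" where t: "t = op_norm P"
      and S: "simplex_with_nodes_in_ball S" "interpolation_projector S P" by blast
  obtain V g c where "nodes_in_ball V g c" "S = convex hull V"
    using simplex_in_ball_coordinates[OF S(1)] by blast
  then show "(3 * real CARD('n) - 1) / (real CARD('n) + 1) \<le> t"
    using nodes_in_ball.op_norm_ge S(2) unfolding t by blast
qed

theorem theorem3:
  shows "(CARD('n::finite) = 1 \<longrightarrow> theta TYPE('n) = 1) \<and>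
         (CARD('n) = 2 \<longrightarrow> theta TYPE('n) = 5 / 3) \<and>
         (CARD('n) = 3 \<longrightarrow> theta TYPE('n) = 2) \<and>
         (CARD('n) = 4 \<longrightarrow> theta TYPE('n) = 11 / 5) \<and>
         (CARD('n) \<le> 4 \<longrightarrow>
            (\<exists>(S :: (real ^ 'n) set) P. simplex_with_nodes_in_ball S \<and>
               interpolation_projector S P \<and> op_norm P = theta TYPE('n)) \<and>
            (\<forall>(S :: (real ^ 'n) set) P. simplex_with_nodes_in_ball S \<longrightarrow>
               interpolation_projector S P \<longrightarrow> op_norm P = theta TYPE('n) \<longrightarrow>
               regular_simplex S \<and> inscribed S))"
proof (intro conjI impI allI)
  fix S :: "(real ^ 'n) set" and P
  assume "CARD('n) \<le> 4" "simplex_with_nodes_in_ball S" and P: "interpolation_projector S P"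
    "op_norm P = theta TYPE('n)"
  then have minimal: "op_norm P = (3 * real CARD('n) - 1) / (real CARD('n) + 1)"
    by (simp add: theta_eq)
  obtain V g c where V: "nodes_in_ball V g c" "S = convex hull V"
    using simplex_in_ball_coordinates \<open>simplex_with_nodes_in_ball S\<close> by blast
  show "regular_simplex S" "inscribed S"
    using nodes_in_ball.regular_inscribed_if_minimal[OF V(1)] V(2) P(1) minimal by auto
qed (use minimal_projector_exists in \<open>auto simp: theta_eq\<close>)

end
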